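(* Let $G$ be a finite simple connected König-Egerváry graph of order $n\ge 2$. Then the following assertions are equivalent: (i) $G$ is square-stable, i.e. $\alpha(G)=\alpha(G^2)$; (ii) $G$ has a perfect matching consisting of pendant edges; (iii) $G$ is very well-covered with exactly $\alpha(G)$ pendant vertices.
   Context: $G^2$ is the graph on $V(G)$ in which distinct vertices $v,w$ are adjacent iff $\mathrm{dist}_G(v,w)\le 2$. $\alpha(G)$ is the maximum cardinality of a stable (independent) set and $\mu(G)$ the maximum cardinality of a matching. $G$ is a König-Egerváry graph if $\alpha(G)+\mu(G)=|V(G)|$. A vertex $v$ is pendant if it has exactly one neighbor $w$, and then $vw$ is called a pendant edge. A perfect matching is a matching covering all vertices. $G$ is well-covered if it has no isolated vertices and every (inclusion-)maximal stable set has cardinality $\alpha(G)$; $G$ is very well-covered if it is well-covered and $|V(G)|=2\alpha(G)$.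
   Formalization: For n = 2 (G = K_2) the implications from (i) and (ii) to (iii) fail, since both vertices are pendant while α(G) = 1; so (i) ⟹ (iii) is asserted only for n ≠ 2, while (i) ⟺ (ii) and (iii) ⟹ (i) are asserted for all n ≥ 2. *)

theory Defs
  imports "Graph_Theory.Graph_Theory"
begin

text \<open>
  A finite simple graph is a \<open>pair_graph\<close>: a finite, loop-free, symmetric arc relation
  on a finite vertex set. Its undirected edges are the two-element sets of endpoints of its arcs.
\<close>

definition edges :: "'a pair_pre_digraph \<Rightarrow> 'a set set" where
  "edges G = {{u, v} | u v. (u, v) \<in> parcs G}"

definition stable_set :: "'a pair_pre_digraph \<Rightarrow> 'a set \<Rightarrow> bool" where
  "stable_set G S \<longleftrightarrow> S \<subseteq> pverts G \<and> (\<forall>v\<in>S. \<forall>w\<in>S. (v, w) \<notin> parcs G)"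

definition stability_number :: "'a pair_pre_digraph \<Rightarrow> nat" where
  "stability_number G = Max {card S | S. stable_set G S}"

definition matching :: "'a pair_pre_digraph \<Rightarrow> 'a set set \<Rightarrow> bool" where
  "matching G M \<longleftrightarrow> M \<subseteq> edges G \<and> (\<forall>e\<in>M. \<forall>f\<in>M. e \<noteq> f \<longrightarrow> e \<inter> f = {})"

definition matching_number :: "'a pair_pre_digraph \<Rightarrow> nat" where
  "matching_number G = Max {card M | M. matching G M}"

definition perfect_matching :: "'a pair_pre_digraph \<Rightarrow> 'a set set \<Rightarrow> bool" where
  "perfect_matching G M \<longleftrightarrow> matching G M \<and> \<Union>M = pverts G"

definition koenig_egervary :: "'a pair_pre_digraph \<Rightarrow> bool" where
  "koenig_egervary G \<longleftrightarrow> stability_number G + matching_number G = card (pverts G)"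

text \<open>Shortest-path distance with unit arc weights; it is infinite between different components.\<close>

definition graph_dist :: "'a pair_pre_digraph \<Rightarrow> 'a \<Rightarrow> 'a \<Rightarrow> ereal" where
  "graph_dist G v w = wf_digraph.\<mu> (with_proj G) (\<lambda>_. 1) v w"

definition graph_square :: "'a pair_pre_digraph \<Rightarrow> 'a pair_pre_digraph" where
  "graph_square G = \<lparr> pverts = pverts G,
     parcs = {(v, w). v \<in> pverts G \<and> w \<in> pverts G \<and> v \<noteq> w \<and> graph_dist G v w \<le> 2} \<rparr>"

definition square_stable :: "'a pair_pre_digraph \<Rightarrow> bool" where
  "square_stable G \<longleftrightarrow> stability_number G = stability_number (graph_square G)"

definition pendant_vertex :: "'a pair_pre_digraph \<Rightarrow> 'a \<Rightarrow> bool" where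
  "pendant_vertex G v \<longleftrightarrow> v \<in> pverts G \<and> (\<exists>!w. (v, w) \<in> parcs G)"

definition pendant_edge :: "'a pair_pre_digraph \<Rightarrow> 'a set \<Rightarrow> bool" where
  "pendant_edge G e \<longleftrightarrow> e \<in> edges G \<and> (\<exists>v\<in>e. pendant_vertex G v)"

definition isolated_vertex :: "'a pair_pre_digraph \<Rightarrow> 'a \<Rightarrow> bool" where
  "isolated_vertex G v \<longleftrightarrow> v \<in> pverts G \<and> (\<forall>w. (v, w) \<notin> parcs G)"

definition maximal_stable_set :: "'a pair_pre_digraph \<Rightarrow> 'a set \<Rightarrow> bool" where
  "maximal_stable_set G S \<longleftrightarrow> stable_set G S \<and> (\<forall>T. stable_set G T \<and> S \<subseteq> T \<longrightarrow> T = S)"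

definition well_covered :: "'a pair_pre_digraph \<Rightarrow> bool" where
  "well_covered G \<longleftrightarrow> (\<nexists>v. isolated_vertex G v) \<and>
     (\<forall>S. maximal_stable_set G S \<longrightarrow> card S = stability_number G)"

definition very_well_covered :: "'a pair_pre_digraph \<Rightarrow> bool" where
  "very_well_covered G \<longleftrightarrow> well_covered G \<and> card (pverts G) = 2 * stability_number G"

text \<open>
  In a graph of order 2 both vertices are pendant, so the equivalence of being square-stable with
  being very well-covered with exactly \<open>\<alpha>(G)\<close> pendant vertices breaks down
  for the complete graph \<open>K\<^sub>2\<close>.
\<close>

definition K2 :: "bool pair_pre_digraph" where
  "K2 = \<lparr> pverts = UNIV, parcs = {(a, b). a \<noteq> b} \<rparr>"

lemma pair_graph_K2: "pair_graph K2"
  by unfold_locales (auto simp: K2_def symmetric_def sym_def)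

lemma connected_K2: "Digraph_Component.connected (with_proj K2)"
proof -
  have "(u, v) \<in> rtrancl_on UNIV {(a, b). a \<noteq> b}" for u v :: bool
  proof (cases "u = v")
    case False
    then show ?thesis by (intro rtrancl_on_into_rtrancl_on[OF rtrancl_on_refl]) auto
  qed auto
  moreover have "mk_symmetric (with_proj K2) = K2"
    by (auto simp: mk_symmetric_def K2_def)
  ultimately show ?thesis
    by (simp add: Digraph_Component.connected_def strongly_connected_def reachable_def K2_def)
qed

lemma stable_set_K2: "stable_set K2 S \<longleftrightarrow> S = {} \<or> S = {True} \<or> S = {False}"
proof -
  have "S \<in> {{}, {True}, {False}, UNIV}"
    using Pow_UNIV[where 'a = bool] by (auto simp: UNIV_bool Pow_insert)
  then show ?thesis unfolding stable_set_def K2_def by auto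
qed

lemma stability_number_K2: "stability_number K2 = 1"
proof -
  have "{card S | S. stable_set K2 S} = card ` {{}, {True}, {False}}"
    unfolding stable_set_K2 by blast
  then show ?thesis by (simp add: stability_number_def)
qed

lemma matching_number_K2: "matching_number K2 = 1"
proof -
  have "edges K2 = {UNIV}"
    unfolding edges_def K2_def by (auto simp: UNIV_bool intro: exI[of _ True] exI[of _ False])
  then have "matching K2 M \<longleftrightarrow> M = {} \<or> M = {UNIV}" for M
    unfolding matching_def by (auto simp only: subset_singleton_iff)
  then have "Collect (matching K2) = {{}, {UNIV}}" by (intro set_eqI) simp
  then show ?thesis by (simp add: matching_number_def setcompr_eq_image)
qed

lemma graph_square_K2: "graph_square K2 = K2"
proof -
  interpret pair_graph K2 by (rule pair_graph_K2)
  have "graph_dist K2 v w \<le> 2" if "v \<noteq> w" for v w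
  proof -
    have "pre_digraph.awalk (with_proj K2) v [(v, w)] w"
      using that by (auto simp: pre_digraph.awalk_def pre_digraph.cas.simps K2_def)
    then have "graph_dist K2 v w \<le> ereal (awalk_cost (\<lambda>_. 1) [(v, w)])"
      unfolding graph_dist_def by (intro wf_digraph.min_cost_le_walk_cost) unfold_locales
    also have "\<dots> \<le> 2" by simp
    finally show ?thesis .
  qed
  then show ?thesis by (auto simp: graph_square_def K2_def)
qed

lemma K2_exception:
  "pair_graph K2" "Digraph_Component.connected (with_proj K2)" "koenig_egervary K2"
  "card (pverts K2) = 2" "square_stable K2"
  "card {v. pendant_vertex K2 v} \<noteq> stability_number K2"
proof -
  have "{v. pendant_vertex K2 v} = UNIV"
    unfolding pendant_vertex_def K2_def by auto
  then show "card {v. pendant_vertex K2 v} \<noteq> stability_number K2"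
    by (simp add: stability_number_K2)
  show "card (pverts K2) = 2" by (simp add: K2_def)
  then show "koenig_egervary K2"
    by (simp add: koenig_egervary_def stability_number_K2 matching_number_K2)
  show "square_stable K2" by (simp add: square_stable_def graph_square_K2)
qed (fact pair_graph_K2 connected_K2)+

lemma graph_square_arc_iff:
  assumes "pair_graph G"
  shows "(v, w) \<in> parcs (graph_square G) \<longleftrightarrow>
    v \<noteq> w \<and> ((v, w) \<in> parcs G \<or> (\<exists>u. (v, u) \<in> parcs G \<and> (u, w) \<in> parcs G))"
proof -
  interpret pair_graph G by (rule assms)
  let ?W = "pre_digraph.awalk (with_proj G)"
  have wf: "wf_digraph (with_proj G)" by unfold_locales
  have cost: "awalk_cost (\<lambda>_. 1) p = real (length p)" for p :: "('a \<times> 'a) list"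
    by (induction p) auto
  have le: "graph_dist G v w \<le> 2 \<longleftrightarrow> (\<exists>p. ?W v p w \<and> length p \<le> 2)"
  proof
    assume "graph_dist G v w \<le> 2"
    then have "graph_dist G v w < 3" by (rule order.strict_trans1) simp
    then obtain p where "?W v p w" "ereal (awalk_cost (\<lambda>_. 1) p) < 3"
      unfolding graph_dist_def wf_digraph.\<mu>_def[OF wf] INF_less_iff by auto
    then show "\<exists>p. ?W v p w \<and> length p \<le> 2"
      unfolding cost by (intro exI[of _ p]) simp
  next
    assume "\<exists>p. ?W v p w \<and> length p \<le> 2"
    then obtain p where p: "?W v p w" "length p \<le> 2" by blast
    have "graph_dist G v w \<le> ereal (awalk_cost (\<lambda>_. 1) p)"
      unfolding graph_dist_def by (rule wf_digraph.min_cost_le_walk_cost[OF wf p(1)])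
    also have "\<dots> \<le> 2" using p(2) unfolding cost by simp
    finally show "graph_dist G v w \<le> 2" .
  qed
  have "(v \<in> pverts G \<and> w \<in> pverts G \<and> v \<noteq> w \<and> (\<exists>p. ?W v p w \<and> length p \<le> 2)) \<longleftrightarrow>
    v \<noteq> w \<and> ((v, w) \<in> parcs G \<or> (\<exists>u. (v, u) \<in> parcs G \<and> (u, w) \<in> parcs G))" (is "?L \<longleftrightarrow> ?R")
  proof
    assume ?L
    then obtain p where p: "v \<noteq> w" "?W v p w" "length p \<le> 2" by blast
    then consider "p = []" | e where "p = [e]" | e f where "p = [e, f]"
      by (cases p; cases "tl p") auto
    then show ?R
      using p(1,2) by cases (auto simp: pre_digraph.awalk_def pre_digraph.cas.simps)
  next
    assume R: ?R
    then have "?W v [(v, w)] w \<or> (\<exists>u. ?W v [(v, u), (u, w)] w)"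
      by (auto simp: pre_digraph.awalk_def pre_digraph.cas.simps dest: in_arcsD1)
    then have "\<exists>p. ?W v p w \<and> length p \<le> 2"
    proof (elim disjE exE)
      assume "?W v [(v, w)] w"
      then show ?thesis by (intro exI[of _ "[(v, w)]"]) simp
    next
      fix u assume "?W v [(v, u), (u, w)] w"
      then show ?thesis by (intro exI[of _ "[(v, u), (u, w)]"]) simp
    qed
    moreover have "v \<in> pverts G" "w \<in> pverts G" using R by (auto dest: in_arcsD1 in_arcsD2)
    ultimately show ?L using R by blast
  qed
  then show ?thesis unfolding le[symmetric] by (simp add: graph_square_def)
qed

end

theory Submission
  imports Defs
begin

text \<open>
  Both directions rest on counting across a matching.

  If \<open>S\<close> is a stable set of \<open>G\<^sup>2\<close> with \<open>\<alpha>(G)\<close> vertices, the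
  Koenig-Egervary equation says that a maximum matching \<open>M\<close> has exactly \<open>|V - S|\<close>
  edges. No edge lies inside \<open>S\<close>, so every edge of \<open>M\<close> uses up at least one vertex of
  \<open>V - S\<close>; hence it uses exactly one, and \<open>M\<close> matches all of \<open>V - S\<close> into \<open>S\<close>
  (\<open>matching_joins_stable_complement\<close>). Stability in \<open>G\<^sup>2\<close> implies that a vertex
  has at most one neighbour in \<open>S\<close>. Therefore every neighbour of a given \<open>s \<in> S\<close> is matched to
  \<open>s\<close> itself: as \<open>s\<close> is not isolated, it is matched, and as \<open>M\<close> is a matching, it has only
  one neighbour. So \<open>M\<close> is a perfect matching of pendant edges
  (\<open>square_stable_imp_pendant_matching\<close>).

  Conversely, one pendant vertex from each edge of such a matching gives a stable set of
  \<open>G\<^sup>2\<close>, because the only neighbour of a pendant vertex is its partner and distinct edges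
  have distinct partners. It has \<open>|M|\<close> vertices, and no stable set of \<open>G\<close> has more
  (\<open>pendant_matching_imp_square_stable\<close>). Each maximal stable set meets each edge of \<open>M\<close>,
  since otherwise the pendant end of a missed edge could be added; hence \<open>G\<close> is very
  well-covered (\<open>pendant_matching_imp_very_well_covered\<close>).

  The number of pendant vertices is \<open>|M|\<close> unless some edge of \<open>M\<close> has two pendant ends. By
  connectedness such an edge is the whole graph, which is why order 2 is special. In the other
  direction, a very well-covered Koenig-Egervary graph has a perfect matching, so
  distinct pendant vertices have distinct neighbours, and the \<open>\<alpha>(G)\<close> pendant vertices are
  stable in \<open>G\<^sup>2\<close>.
\<close>

section \<open>Stable sets and matchings\<close>

lemma finite_stable_set_cards:
  assumes "finite (pverts G)"
  shows "finite {card S | S. stable_set G S}"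
proof -
  have "{card S | S. stable_set G S} \<subseteq> card ` Pow (pverts G)"
    by (auto simp: stable_set_def)
  then show ?thesis
    using assms by (meson finite_Pow_iff finite_imageI finite_subset)
qed

lemma card_le_stability_number:
  assumes "finite (pverts G)" "stable_set G S"
  shows "card S \<le> stability_number G"
proof -
  show ?thesis
    unfolding stability_number_def using finite_stable_set_cards[OF assms(1)] assms(2)
    by (intro Max_ge) auto
qed

lemma maximum_stable_set:
  assumes "finite (pverts G)"
  obtains S where "stable_set G S" "card S = stability_number G"
proof -
  have "stable_set G {}" by (simp add: stable_set_def)
  then have "{card S | S. stable_set G S} \<noteq> {}" by blast
  then have "stability_number G \<in> {card S | S. stable_set G S}"
    unfolding stability_number_def by (intro Max_in finite_stable_set_cards assms)
  with that show ?thesis by auto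
qed

lemma matching_unique_edge:
  assumes "matching G M" "e \<in> M" "f \<in> M" "v \<in> e" "v \<in> f"
  shows "e = f"
  using assms unfolding matching_def by blast

lemma matching_choice_inj_on:
  assumes "matching G M" "\<And>e. e \<in> M \<Longrightarrow> f e \<in> e"
  shows "inj_on f M"
  by (rule inj_onI) (metis assms matching_unique_edge)

context pair_graph
begin

lemma edge_partner:
  assumes "e \<in> edges G" "v \<in> e"
  obtains w where "e = {v, w}" "(v, w) \<in> parcs G" "v \<noteq> w"
proof -
  obtain a b where ab: "e = {a, b}" "(a, b) \<in> parcs G"
    using assms(1) unfolding edges_def by blast
  then have "(b, a) \<in> parcs G" "a \<noteq> b"
    using arcs_symmetric no_loops' by auto
  then show ?thesis using that ab assms(2) by auto
qed

lemma edge_subset_pverts: "e \<in> edges G \<Longrightarrow> e \<subseteq> pverts G"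
  unfolding edges_def by (auto dest: in_arcsD1 in_arcsD2)

lemma card_edge: "e \<in> edges G \<Longrightarrow> card e = 2"
  unfolding edges_def using no_loops' by (auto simp: card_insert_if)

lemma finite_edges: "finite (edges G)"
  using edge_subset_pverts by (intro finite_subset[of "edges G" "Pow (pverts G)"]) auto

lemma finite_matching: "matching G M \<Longrightarrow> finite M"
  unfolding matching_def using finite_edges finite_subset by blast

lemma maximum_matching:
  obtains M where "matching G M" "card M = matching_number G"
proof -
  have "{card M | M. matching G M} \<subseteq> card ` Pow (edges G)"
    by (auto simp: matching_def)
  then have "finite {card M | M. matching G M}"
    using finite_edges by (meson finite_Pow_iff finite_imageI finite_subset)
  moreover have "matching G {}" by (simp add: matching_def)
  then have "{card M | M. matching G M} \<noteq> {}" by blast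
  ultimately have "matching_number G \<in> {card M | M. matching G M}"
    unfolding matching_number_def by (rule Max_in)
  with that show ?thesis by auto
qed

lemma card_Union_matching:
  assumes "matching G M"
  shows "card (\<Union>M) = 2 * card M"
proof -
  have *: "card e = 2" "finite e" if "e \<in> M" for e
  proof -
    show "card e = 2" using that assms card_edge unfolding matching_def by blast
    then show "finite e" by (intro card_ge_0_finite) simp
  qed
  have "card (\<Union>M) = sum card M"
    using assms * by (intro card_Union_disjoint) (auto simp: matching_def pairwise_def disjnt_def)
  then show ?thesis using * by simp
qed

lemma card_stable_set_le_perfect_matching:
  assumes "perfect_matching G M" "stable_set G S"
  shows "card S \<le> card M"
proof -
  have M: "matching G M" "\<Union>M = pverts G"
    using assms(1) by (auto simp: perfect_matching_def)
  have "\<forall>v\<in>S. \<exists>e\<in>M. v \<in> e"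
    using assms(2) M(2) unfolding stable_set_def by blast
  then obtain e where e: "\<And>v. v \<in> S \<Longrightarrow> e v \<in> M \<and> v \<in> e v" by metis
  have "inj_on e S"
  proof (rule inj_onI)
    fix v w assume vw: "v \<in> S" "w \<in> S" "e v = e w"
    have "e v \<in> edges G" "v \<in> e v" using e[OF vw(1)] M(1) by (auto simp: matching_def)
    then obtain u where "e v = {v, u}" "(v, u) \<in> parcs G"
      by (rule edge_partner)
    moreover have "(v, w) \<notin> parcs G" using assms(2) vw by (auto simp: stable_set_def)
    ultimately show "v = w" using e[OF vw(2)] vw(3) by auto
  qed
  then show ?thesis
    using e finite_matching[OF M(1)] by (intro card_inj_on_le) auto
qed

text \<open>
  An edge of the matching has an end outside \<open>S\<close>, and distinct edges give distinct such ends. The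
  hypothesis on the cardinalities makes this choice of ends exhaust the complement of \<open>S\<close>, so
  the other end of each edge has nowhere left to be but in \<open>S\<close>.
\<close>

lemma matching_joins_stable_complement:
  assumes S: "stable_set G S" and M: "matching G M"
    and card: "card M = card (pverts G - S)" and v: "v \<in> pverts G - S"
  obtains s where "s \<in> S" "{v, s} \<in> M" "(v, s) \<in> parcs G"
proof -
  have edge: "e \<in> edges G" if "e \<in> M" for e using M that by (auto simp: matching_def)
  have "\<exists>u\<in>e. u \<notin> S" if "e \<in> M" for e
    using S edge[OF that] unfolding stable_set_def edges_def by blast
  then obtain f where f: "\<And>e. e \<in> M \<Longrightarrow> f e \<in> e \<and> f e \<notin> S" by metis
  have "f ` M \<subseteq> pverts G - S" using f edge edge_subset_pverts by blast
  moreover have "card (f ` M) = card M"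
    using matching_choice_inj_on[OF M, of f] f by (simp add: card_image)
  ultimately have onto: "f ` M = pverts G - S"
    using card by (intro card_subset_eq) auto
  then have "v \<in> f ` M" using v by simp
  then obtain e where e: "e \<in> M" "f e = v" by auto
  then obtain s where s: "e = {v, s}" "(v, s) \<in> parcs G" "v \<noteq> s"
    using edge_partner[OF edge[OF e(1)]] f by blast
  have "s \<in> S"
  proof (rule ccontr)
    assume "s \<notin> S"
    then have "s \<in> f ` M" using onto s(2) in_arcsD2 by auto
    then obtain e' where e': "e' \<in> M" "f e' = s" by blast
    then have "e' = e" using matching_unique_edge[OF M] f e s(1) by blast
    then show False using e e' s(3) by simp
  qed
  then show ?thesis using that s e by blast
qed

lemma koenig_egervary_perfect_matching:
  assumes "koenig_egervary G" "card (pverts G) = 2 * stability_number G"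
  obtains M where "perfect_matching G M"
proof -
  obtain M where M: "matching G M" "card M = matching_number G" by (rule maximum_matching)
  have "card (\<Union>M) = card (pverts G)"
    using card_Union_matching[OF M(1)] M(2) assms by (simp add: koenig_egervary_def)
  moreover have "\<Union>M \<subseteq> pverts G"
    using M(1) edge_subset_pverts unfolding matching_def by blast
  ultimately have "\<Union>M = pverts G" by (intro card_subset_eq) auto
  with M(1) that show ?thesis by (auto simp: perfect_matching_def)
qed

section \<open>Stable sets of the square\<close>

lemma stable_set_square_iff:
  "stable_set (graph_square G) S \<longleftrightarrow>
    stable_set G S \<and>
    (\<forall>v\<in>S. \<forall>w\<in>S. \<forall>u. (v, u) \<in> parcs G \<longrightarrow> (w, u) \<in> parcs G \<longrightarrow> v = w)"
proof -
  have "pverts (graph_square G) = pverts G" by (simp add: graph_square_def)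
  then show ?thesis
    unfolding stable_set_def graph_square_arc_iff[OF pair_graph_axioms]
    using arcs_symmetric no_loops' by (safe; blast)
qed

lemma stable_set_squareI:
  assumes "S \<subseteq> pverts G" "\<And>v w. v \<in> S \<Longrightarrow> w \<in> S \<Longrightarrow> (v, w) \<notin> parcs G"
    and "\<And>v w u. v \<in> S \<Longrightarrow> w \<in> S \<Longrightarrow> (v, u) \<in> parcs G \<Longrightarrow> (w, u) \<in> parcs G \<Longrightarrow> v = w"
  shows "stable_set (graph_square G) S"
  using assms unfolding stable_set_square_iff by (simp add: stable_set_def)

text \<open>
  A stable set of the square is stable in \<open>G\<close>, so \<open>\<alpha>(G\<^sup>2) \<le> \<alpha>(G)\<close> always, and
  equality means that \<open>\<alpha>(G)\<close> is attained by such a set.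
\<close>

lemma square_stable_iff:
  "square_stable G \<longleftrightarrow>
    (\<exists>S. stable_set (graph_square G) S \<and> card S = stability_number G)"
proof -
  have fin: "finite (pverts (graph_square G))" by (simp add: graph_square_def)
  obtain S where S: "stable_set (graph_square G) S"
      "card S = stability_number (graph_square G)"
    using maximum_stable_set[OF fin] .
  then have "stability_number (graph_square G) \<le> stability_number G"
    using card_le_stability_number[of G S] by (simp add: stable_set_square_iff)
  then show ?thesis
    using S card_le_stability_number[OF fin] unfolding square_stable_def by fastforce
qed

section \<open>Connectedness\<close>

lemma connected_closed_set:
  assumes conn: "Digraph_Component.connected (with_proj G)"
    and "v \<in> C" "v \<in> pverts G"
    and closed: "\<And>a b. a \<in> C \<Longrightarrow> (a, b) \<in> parcs G \<Longrightarrow> b \<in> C"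
  shows "pverts G \<subseteq> C"
proof
  fix w assume "w \<in> pverts G"
  then have "(v, w) \<in> rtrancl_on (pverts G) (parcs (mk_symmetric (with_proj G)))"
    using conn assms(3)
    by (simp add: Digraph_Component.connected_def strongly_connected_def reachable_def)
  then show "w \<in> C"
  proof (induction rule: rtrancl_on_induct)
    case base
    show ?case by fact
  next
    case (step a b)
    then show ?case using closed arcs_symmetric by (auto simp: mk_symmetric_def)
  qed
qed

lemma connected_no_isolated:
  assumes "Digraph_Component.connected (with_proj G)" "card (pverts G) \<ge> 2"
  shows "\<not> isolated_vertex G v"
proof
  assume iso: "isolated_vertex G v"
  then have "pverts G \<subseteq> {v}"
    using assms(1) by (intro connected_closed_set[of v]) (auto simp: isolated_vertex_def)
  then have "card (pverts G) \<le> card {v}" by (intro card_mono) auto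
  then show False using assms(2) by simp
qed

lemma pendant_vertex_neighbour_unique:
  "pendant_vertex G v \<Longrightarrow> (v, a) \<in> parcs G \<Longrightarrow> (v, b) \<in> parcs G \<Longrightarrow> a = b"
  unfolding pendant_vertex_def by blast

lemma connected_adjacent_pendants:
  assumes "Digraph_Component.connected (with_proj G)"
    and p: "pendant_vertex G p" and q: "pendant_vertex G q" and pq: "(p, q) \<in> parcs G"
  shows "pverts G = {p, q}"
proof
  have "(q, p) \<in> parcs G" using pq arcs_symmetric by blast
  then show "pverts G \<subseteq> {p, q}"
    using assms pendant_vertex_neighbour_unique in_arcsD1[OF pq]
    by (intro connected_closed_set[of p]) blast+
  show "{p, q} \<subseteq> pverts G"
    using p q by (auto simp: pendant_vertex_def)
qed

section \<open>Perfect matchings consisting of pendant edges\<close>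

text \<open>
  A maximum matching already works. Let \<open>S\<close> be a stable set of the square with \<open>\<alpha>(G)\<close>
  vertices. The matching joins the complement of \<open>S\<close> to \<open>S\<close>, and every edge of \<open>G\<close> that touches \<open>S\<close> belongs to it, because vertices
  outside \<open>S\<close> have a single neighbour in \<open>S\<close>. This makes the vertices of \<open>S\<close> pendant.
\<close>

lemma square_stable_imp_pendant_matching:
  assumes ke: "koenig_egervary G" and ss: "square_stable G"
    and no_iso: "\<And>v. \<not> isolated_vertex G v"
  obtains M where "perfect_matching G M" "\<And>e. e \<in> M \<Longrightarrow> pendant_edge G e"
proof -
  obtain S where S2: "stable_set (graph_square G) S" and cS: "card S = stability_number G"
    using ss square_stable_iff by blast
  then have S: "stable_set G S"
    and one: "\<And>v w u. v \<in> S \<Longrightarrow> w \<in> S \<Longrightarrow> (v, u) \<in> parcs G \<Longrightarrow> (w, u) \<in> parcs G \<Longrightarrow> v = w"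
    by (auto simp: stable_set_square_iff)
  have SV: "S \<subseteq> pverts G" using S by (simp add: stable_set_def)
  obtain M where M: "matching G M" "card M = matching_number G" by (rule maximum_matching)
  have "card (pverts G - S) = card M"
    using card_Diff_subset[OF finite_subset[OF SV] SV] M(2) cS ke
    by (simp add: koenig_egervary_def)
  note join = matching_joins_stable_complement[OF S M(1) this[symmetric]]
  (* The partner of u in S is a neighbour of u in S, and s is the only one. *)
  have nb: "{u, s} \<in> M" if "s \<in> S" "(s, u) \<in> parcs G" for s u
  proof -
    have "u \<in> pverts G - S" using S that in_arcsD2 by (auto simp: stable_set_def)
    then obtain s' where "s' \<in> S" "{u, s'} \<in> M" "(u, s') \<in> parcs G" by (rule join)
    moreover from this have "s' = s" using one that arcs_symmetric by blast
    ultimately show ?thesis by simp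
  qed
  have neighbour: "\<exists>u. (s, u) \<in> parcs G" if "s \<in> S" for s
    using no_iso[of s] that SV by (auto simp: isolated_vertex_def)
  have pend: "pendant_vertex G s" if s: "s \<in> S" for s
  proof -
    have "u = u'" if "(s, u) \<in> parcs G" "(s, u') \<in> parcs G" for u u'
    proof -
      have "{u, s} = {u', s}"
        using matching_unique_edge[OF M(1) nb[OF s that(1)] nb[OF s that(2)]] by blast
      then show ?thesis by (auto simp: doubleton_eq_iff)
    qed
    then show ?thesis using neighbour[OF s] s SV unfolding pendant_vertex_def by blast
  qed
  have cover: "\<exists>s\<in>S. \<exists>e\<in>M. v \<in> e \<and> s \<in> e" if v: "v \<in> pverts G" for v
  proof (cases "v \<in> S")
    case True
    then obtain u where "(v, u) \<in> parcs G" using neighbour by blast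
    then have "{u, v} \<in> M" using nb True by simp
    then show ?thesis using True by (intro bexI[of _ v] bexI[of _ "{u, v}"]) auto
  next
    case False
    then have "v \<in> pverts G - S" using v by simp
    then obtain s where "s \<in> S" "{v, s} \<in> M" by (rule join)
    then show ?thesis by (intro bexI[of _ s] bexI[of _ "{v, s}"]) auto
  qed
  have MV: "\<Union>M \<subseteq> pverts G"
    using M(1) edge_subset_pverts unfolding matching_def by blast
  have "perfect_matching G M"
    unfolding perfect_matching_def
  proof (intro conjI subset_antisym subsetI)
    fix v assume "v \<in> pverts G"
    then show "v \<in> \<Union>M" using cover[of v] by blast
  qed (use M(1) MV in blast)+
  moreover have "pendant_edge G e" if e: "e \<in> M" for e
  proof -
    have eE: "e \<in> edges G" using M(1) e by (auto simp: matching_def)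
    obtain v where v: "v \<in> e" using eE unfolding edges_def by blast
    then obtain s f where "s \<in> S" "f \<in> M" "v \<in> f" "s \<in> f" using cover MV e by blast
    moreover from this have "f = e" using matching_unique_edge[OF M(1)] e v by blast
    ultimately show ?thesis using eE pend by (auto simp: pendant_edge_def)
  qed
  ultimately show ?thesis by (rule that)
qed

lemma pendant_matching_choice:
  assumes "\<And>e. e \<in> M \<Longrightarrow> pendant_edge G e"
  obtains f where "\<And>e. e \<in> M \<Longrightarrow> f e \<in> e" "\<And>e. e \<in> M \<Longrightarrow> pendant_vertex G (f e)"
  using assms unfolding pendant_edge_def by metis

text \<open>
  All neighbours of a pendant vertex lie in the matching edge that covers it, so both adjacency and
  a common neighbour of two chosen pendant vertices would make their edges intersect.
\<close>

lemma pendant_matching_stable_square: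
  assumes M: "matching G M" and f: "\<And>e. e \<in> M \<Longrightarrow> f e \<in> e"
    and pend: "\<And>e. e \<in> M \<Longrightarrow> pendant_vertex G (f e)"
  shows "stable_set (graph_square G) (f ` M)"
proof -
  have nb: "u \<in> e \<and> u \<noteq> f e" if e: "e \<in> M" and u: "(f e, u) \<in> parcs G" for e u
  proof -
    have "e \<in> edges G" using e M by (auto simp: matching_def)
    then obtain w where w: "e = {f e, w}" "(f e, w) \<in> parcs G" "f e \<noteq> w"
      using f[OF e] by (rule edge_partner)
    then have "u = w" using pendant_vertex_neighbour_unique[OF pend] e u by blast
    then show ?thesis using w by auto
  qed
  have sub: "f ` M \<subseteq> pverts G" using pend by (auto simp: pendant_vertex_def)
  have nonadj: "(f e, f e') \<notin> parcs G" if e: "e \<in> M" and e': "e' \<in> M" for e e'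
  proof
    assume "(f e, f e') \<in> parcs G"
    then have in_e: "f e' \<in> e" "f e' \<noteq> f e" using nb[OF e] by auto
    then have "e = e'" using matching_unique_edge[OF M e e', of "f e'"] f[OF e'] by simp
    then show False using in_e by simp
  qed
  have apart: "f e = f e'"
    if e: "e \<in> M" and e': "e' \<in> M" and u: "(f e, u) \<in> parcs G" "(f e', u) \<in> parcs G"
    for e e' u
  proof -
    have "e = e'" using matching_unique_edge[OF M e e', of u] nb[OF e u(1)] nb[OF e' u(2)] by simp
    then show ?thesis by simp
  qed
  show ?thesis
  proof (rule stable_set_squareI[OF sub])
    fix v w assume "v \<in> f ` M" "w \<in> f ` M"
    then obtain e e' where e: "e \<in> M" "e' \<in> M" "v = f e" "w = f e'" by blast
    show "(v, w) \<notin> parcs G" using nonadj[OF e(1,2)] e(3,4) by simp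
    show "v = w" if "(v, u) \<in> parcs G" "(w, u) \<in> parcs G" for u
      using apart[OF e(1,2), of u] that e(3,4) by simp
  qed
qed

lemma
  assumes M: "perfect_matching G M" and pend: "\<And>e. e \<in> M \<Longrightarrow> pendant_edge G e"
  shows pendant_matching_stability_number: "stability_number G = card M"
    and pendant_matching_imp_square_stable: "square_stable G"
proof -
  obtain f where f: "\<And>e. e \<in> M \<Longrightarrow> f e \<in> e" "\<And>e. e \<in> M \<Longrightarrow> pendant_vertex G (f e)"
    using pendant_matching_choice[of M, OF pend] by blast
  have mM: "matching G M" using M by (simp add: perfect_matching_def)
  have st: "stable_set (graph_square G) (f ` M)"
    using pendant_matching_stable_square[OF mM f] .
  have card: "card (f ` M) = card M"
    using matching_choice_inj_on[OF mM f(1)] by (rule card_image)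
  obtain S where "stable_set G S" "card S = stability_number G"
    using maximum_stable_set[of G] by auto
  then have "stability_number G \<le> card M"
    using card_stable_set_le_perfect_matching[OF M] by metis
  moreover have "card M \<le> stability_number G"
    using card_le_stability_number[of G "f ` M"] st card by (simp add: stable_set_square_iff)
  ultimately show eq: "stability_number G = card M" by simp
  show "square_stable G" using st card eq unfolding square_stable_iff by auto
qed

lemma pendant_matching_imp_very_well_covered:
  assumes M: "perfect_matching G M" and pend: "\<And>e. e \<in> M \<Longrightarrow> pendant_edge G e"
  shows "very_well_covered G"
proof -
  have mM: "matching G M" and cov: "\<Union>M = pverts G"
    using M by (auto simp: perfect_matching_def)
  have edge: "e \<in> edges G" if "e \<in> M" for e using mM that by (auto simp: matching_def)
  note alpha = pendant_matching_stability_number[OF M pend]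
  have no_iso: "\<not> isolated_vertex G v" for v
  proof
    assume v: "isolated_vertex G v"
    then obtain e where "e \<in> M" "v \<in> e" using cov by (auto simp: isolated_vertex_def)
    then obtain w where "(v, w) \<in> parcs G" using edge edge_partner by blast
    then show False using v by (simp add: isolated_vertex_def)
  qed
  have "card T = stability_number G" if T: "maximal_stable_set G T" for T
  proof -
    have sT: "stable_set G T" using T by (simp add: maximal_stable_set_def)
    (* If T missed e, its pendant end, whose only neighbour also lies in e, could join T. *)
    have "\<exists>t\<in>T. t \<in> e" if e: "e \<in> M" for e
    proof (rule ccontr)
      assume miss: "\<not> ?thesis"
      obtain p where p: "p \<in> e" "pendant_vertex G p"
        using pend[OF e] by (auto simp: pendant_edge_def)
      obtain w where w: "e = {p, w}" "(p, w) \<in> parcs G"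
        using edge_partner[OF edge[OF e] p(1)] by blast
      have "(p, t) \<notin> parcs G" "(t, p) \<notin> parcs G" if "t \<in> T" for t
        using pendant_vertex_neighbour_unique[OF p(2) w(2)] w(1) miss that arcs_symmetric
        by auto
      then have "stable_set G (insert p T)"
        using sT p(2) no_loops' by (auto simp: stable_set_def pendant_vertex_def)
      then have "insert p T = T" using T unfolding maximal_stable_set_def by blast
      then show False using miss p(1) by blast
    qed
    then obtain f where f: "\<And>e. e \<in> M \<Longrightarrow> f e \<in> T \<and> f e \<in> e" by metis
    have "finite T" using sT by (auto simp: stable_set_def intro: finite_subset)
    moreover have "inj_on f M" using matching_choice_inj_on[OF mM] f by blast
    ultimately have "card M \<le> card T" using f by (intro card_inj_on_le) auto
    then show ?thesis
      using card_stable_set_le_perfect_matching[OF M sT] alpha by simp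
  qed
  moreover have "card (pverts G) = 2 * stability_number G"
    using card_Union_matching[OF mM] cov alpha by simp
  ultimately show ?thesis
    using no_iso by (simp add: very_well_covered_def well_covered_def)
qed

text \<open>
  Each edge of the matching has exactly one pendant end, since in a connected graph an edge
  with two would be everything, and the order would be 2.
\<close>

lemma card_pendant_vertices:
  assumes M: "perfect_matching G M" and pend: "\<And>e. e \<in> M \<Longrightarrow> pendant_edge G e"
    and conn: "Digraph_Component.connected (with_proj G)" and "card (pverts G) \<noteq> 2"
  shows "card {v. pendant_vertex G v} = card M"
proof -
  obtain f where f: "\<And>e. e \<in> M \<Longrightarrow> f e \<in> e" "\<And>e. e \<in> M \<Longrightarrow> pendant_vertex G (f e)"
    using pendant_matching_choice[of M, OF pend] by blast
  have mM: "matching G M" and cov: "\<Union>M = pverts G"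
    using M by (auto simp: perfect_matching_def)
  have "p \<in> f ` M" if p: "pendant_vertex G p" for p
  proof -
    obtain e where e: "e \<in> M" "p \<in> e" using p cov unfolding pendant_vertex_def by blast
    then have "e \<in> edges G" using mM by (auto simp: matching_def)
    then obtain w where w: "e = {p, w}" "(p, w) \<in> parcs G" "p \<noteq> w"
      using e(2) by (rule edge_partner)
    have "\<not> pendant_vertex G w"
      using connected_adjacent_pendants[OF conn p _ w(2)] assms(4) w(3) by auto
    then have "f e = p" using f[OF e(1)] w(1) by auto
    then show ?thesis using e(1) by blast
  qed
  then have "{v. pendant_vertex G v} = f ` M" using f(2) by blast
  then show ?thesis using matching_choice_inj_on[OF mM f(1)] by (simp add: card_image)
qed

text \<open>
  The equation \<open>|V(G)| = 2\<alpha>(G)\<close> forces a perfect matching, and it must match each pendant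
  vertex to its only neighbour; so no neighbour is shared and the pendant vertices themselves are
  the stable set of the square. Adjacent pendant vertices would make \<open>G\<close> a single edge, whose
  two pendant vertices outnumber its stability number 1.
\<close>

lemma pendant_count_imp_square_stable:
  assumes ke: "koenig_egervary G" and conn: "Digraph_Component.connected (with_proj G)"
    and two: "card (pverts G) = 2 * stability_number G"
    and count: "card {v. pendant_vertex G v} = stability_number G"
  shows "square_stable G"
proof -
  let ?P = "{v. pendant_vertex G v}"
  obtain M where M: "perfect_matching G M"
    using koenig_egervary_perfect_matching[OF ke two] .
  have mM: "matching G M" and cov: "\<Union>M = pverts G"
    using M by (auto simp: perfect_matching_def)
  have matched: "{p, u} \<in> M" if p: "pendant_vertex G p" and u: "(p, u) \<in> parcs G" for p u
  proof -
    obtain e where e: "e \<in> M" "p \<in> e" using p cov unfolding pendant_vertex_def by blast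
    then have "e \<in> edges G" using mM by (auto simp: matching_def)
    then obtain w where "e = {p, w}" "(p, w) \<in> parcs G" using e(2) by (rule edge_partner)
    then show ?thesis using pendant_vertex_neighbour_unique[OF p u] e(1) by auto
  qed
  have "(p, q) \<notin> parcs G" if p: "pendant_vertex G p" and q: "pendant_vertex G q" for p q
  proof
    assume pq: "(p, q) \<in> parcs G"
    then have V: "pverts G = {p, q}" using connected_adjacent_pendants[OF conn p q] by simp
    have "p \<noteq> q" using pq no_loops' by auto
    moreover have "?P = {p, q}" using V p q by (auto simp: pendant_vertex_def)
    ultimately show False using two count V by simp
  qed
  moreover have "p = q" if "pendant_vertex G p" "pendant_vertex G q"
    "(p, u) \<in> parcs G" "(q, u) \<in> parcs G" for p q u
  proof -
    have "{p, u} = {q, u}"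
      using matching_unique_edge[OF mM matched[OF that(1,3)] matched[OF that(2,4)]] by blast
    then show ?thesis by (auto simp: doubleton_eq_iff)
  qed
  ultimately have "stable_set (graph_square G) ?P"
    by (intro stable_set_squareI) (auto simp: pendant_vertex_def)
  then show ?thesis using count square_stable_iff by blast
qed

end

section \<open>The equivalence\<close>

theorem proposition3p2:
  fixes G :: "'a pair_pre_digraph"
  assumes "pair_graph G"
    and "Digraph_Component.connected (with_proj G)"
    and "koenig_egervary G"
    and "card (pverts G) \<ge> 2"
  shows "(square_stable G \<longleftrightarrow>
      (\<exists>M. perfect_matching G M \<and> (\<forall>e\<in>M. pendant_edge G e))) \<and>
    (very_well_covered G \<and> card {v. pendant_vertex G v} = stability_number G \<longrightarrow>
      square_stable G) \<and>
    (card (pverts G) \<noteq> 2 \<longrightarrow> square_stable G \<longrightarrow>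
      very_well_covered G \<and> card {v. pendant_vertex G v} = stability_number G)"
proof -
  interpret pair_graph G by (rule assms(1))
  have equiv: "square_stable G \<longleftrightarrow>
      (\<exists>M. perfect_matching G M \<and> (\<forall>e\<in>M. pendant_edge G e))"
  proof
    assume ss: "square_stable G"
    show "\<exists>M. perfect_matching G M \<and> (\<forall>e\<in>M. pendant_edge G e)"
      by (rule square_stable_imp_pendant_matching[OF assms(3) ss connected_no_isolated[OF assms(2,4)]])
        blast
  next
    assume "\<exists>M. perfect_matching G M \<and> (\<forall>e\<in>M. pendant_edge G e)"
    then show "square_stable G" using pendant_matching_imp_square_stable by blast
  qed
  moreover have "square_stable G"
    if "very_well_covered G" "card {v. pendant_vertex G v} = stability_number G"
    using pendant_count_imp_square_stable[OF assms(3,2)] that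
    by (simp add: very_well_covered_def)
  moreover have "very_well_covered G \<and> card {v. pendant_vertex G v} = stability_number G"
    if order: "card (pverts G) \<noteq> 2" and ss: "square_stable G"
  proof -
    obtain M where M: "perfect_matching G M" "\<And>e. e \<in> M \<Longrightarrow> pendant_edge G e"
      using equiv ss by blast
    show ?thesis
      using pendant_matching_imp_very_well_covered[OF M] card_pendant_vertices[OF M assms(2) order]
        pendant_matching_stability_number[OF M] by simp
  qed
  ultimately show ?thesis by blast
qed

end
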